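(* (In ZF.) Let $\mathfrak{m}$ be a cardinal. If $\mathfrak{m}\ge 5$ and $\aleph_0\nleq 2^{\mathfrak{m}}$, then $2^{\mathfrak{m}}< \operatorname{part}(\mathfrak{m})$.
   Context: The base theory is ZF (no axiom of choice). The cardinality of a set is its equinumerosity class (represented as a set by Scott's trick). $\mathfrak{p}\le\mathfrak{q}$ means there is an injection from a set of cardinality $\mathfrak{p}$ into a set of cardinality $\mathfrak{q}$; $\mathfrak{p}<\mathfrak{q}$ means $\mathfrak{p}\le\mathfrak{q}$ and $\mathfrak{p}\ne\mathfrak{q}$. $\aleph_0$ is the cardinality of $\mathbb{N}$. For a set $m$ of cardinality $\mathfrak{m}$: $2^{\mathfrak{m}}$ is the cardinality of the power set of $m$; a partition of $m$ is a set $p$ of pairwise disjoint non-empty subsets of $m$ with $\bigcup p=m$; $\operatorname{part}(\mathfrak{m})$ is the cardinality of the set $\operatorname{part}(m)$ of all partitions of $m$. *)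

theory Defs
  imports Main
begin

text \<open>
  The theorem belongs to ZF without choice, whereas HOL proves the axiom of choice. It is therefore
  stated for an arbitrary model of first-order ZF: a type with a binary relation \<open>E\<close>
  (\<open>E x y\<close> reads ``x is an element of y'') satisfying the axioms. Separation and
  Replacement range over first-order formulas with parameters only. With arbitrary HOL predicates
  in their place, the choice principle of HOL would carry over to the model.

  All sets, functions and bijections below are elements of the model. Only the equinumerosity
  classes, which are proper classes of the model, are HOL sets; this makes Scott's trick
  unnecessary.
\<close>

datatype fm =
    Mem nat nat
  | Eq nat nat
  | Neg fm
  | Conj fm fm
  | Forall nat fm

primrec sat :: "('a \<Rightarrow> 'a \<Rightarrow> bool) \<Rightarrow> (nat \<Rightarrow> 'a) \<Rightarrow> fm \<Rightarrow> bool" where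
  "sat E v (Mem i j) \<longleftrightarrow> E (v i) (v j)"
| "sat E v (Eq i j) \<longleftrightarrow> v i = v j"
| "sat E v (Neg \<phi>) \<longleftrightarrow> \<not> sat E v \<phi>"
| "sat E v (Conj \<phi> \<psi>) \<longleftrightarrow> sat E v \<phi> \<and> sat E v \<psi>"
| "sat E v (Forall i \<phi>) \<longleftrightarrow> (\<forall>x. sat E (v(i := x)) \<phi>)"

definition subset_of :: "('a \<Rightarrow> 'a \<Rightarrow> bool) \<Rightarrow> 'a \<Rightarrow> 'a \<Rightarrow> bool" where
  "subset_of E x y \<longleftrightarrow> (\<forall>z. E z x \<longrightarrow> E z y)"

definition is_empty :: "('a \<Rightarrow> 'a \<Rightarrow> bool) \<Rightarrow> 'a \<Rightarrow> bool" where
  "is_empty E x \<longleftrightarrow> (\<forall>z. \<not> E z x)"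

definition is_succ :: "('a \<Rightarrow> 'a \<Rightarrow> bool) \<Rightarrow> 'a \<Rightarrow> 'a \<Rightarrow> bool" where
  "is_succ E s x \<longleftrightarrow> (\<forall>z. E z s \<longleftrightarrow> E z x \<or> z = x)"

definition is_inductive :: "('a \<Rightarrow> 'a \<Rightarrow> bool) \<Rightarrow> 'a \<Rightarrow> bool" where
  "is_inductive E w \<longleftrightarrow>
     (\<exists>e. is_empty E e \<and> E e w) \<and> (\<forall>x. E x w \<longrightarrow> (\<exists>s. is_succ E s x \<and> E s w))"

text \<open>
  In the two schemas the valuation \<open>v\<close> supplies the parameters; variable 0 (and, in
  Replacement, variable 1 for the value) is the argument of the class or class function.
\<close>

definition ZF_model :: "('a \<Rightarrow> 'a \<Rightarrow> bool) \<Rightarrow> bool" where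
  "ZF_model E \<longleftrightarrow>
     \<comment> \<open>Extensionality\<close>
     (\<forall>x y. (\<forall>z. E z x \<longleftrightarrow> E z y) \<longrightarrow> x = y) \<and>
     \<comment> \<open>Foundation\<close>
     (\<forall>x. (\<exists>y. E y x) \<longrightarrow> (\<exists>y. E y x \<and> \<not> (\<exists>z. E z x \<and> E z y))) \<and>
     \<comment> \<open>Pairing\<close>
     (\<forall>x y. \<exists>p. \<forall>z. E z p \<longleftrightarrow> z = x \<or> z = y) \<and>
     \<comment> \<open>Union\<close>
     (\<forall>x. \<exists>u. \<forall>z. E z u \<longleftrightarrow> (\<exists>y. E y x \<and> E z y)) \<and>
     \<comment> \<open>Power set\<close>
     (\<forall>x. \<exists>p. \<forall>z. E z p \<longleftrightarrow> subset_of E z x) \<and>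
     \<comment> \<open>Infinity\<close>
     (\<exists>w. is_inductive E w) \<and>
     \<comment> \<open>Separation\<close>
     (\<forall>\<phi> v x. \<exists>y. \<forall>z. E z y \<longleftrightarrow> E z x \<and> sat E (v(0 := z)) \<phi>) \<and>
     \<comment> \<open>Replacement\<close>
     (\<forall>\<phi> v x.
        (\<forall>a b c. E a x \<and> sat E (v(0 := a, 1 := b)) \<phi> \<and> sat E (v(0 := a, 1 := c)) \<phi> \<longrightarrow> b = c) \<longrightarrow>
        (\<exists>y. \<forall>b. E b y \<longleftrightarrow> (\<exists>a. E a x \<and> sat E (v(0 := a, 1 := b)) \<phi>)))"

text \<open>
  The element of the model whose members are exactly the \<open>z\<close> with \<open>P z\<close>. The description is
  meaningful only if such an element exists; \<open>the_set_mem\<close> and the lemmas at the end of this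
  theory show that it does, in every model of ZF, for each use below.
\<close>

definition the_set :: "('a \<Rightarrow> 'a \<Rightarrow> bool) \<Rightarrow> ('a \<Rightarrow> bool) \<Rightarrow> 'a" where
  "the_set E P = (THE y. \<forall>z. E z y \<longleftrightarrow> P z)"

definition Power :: "('a \<Rightarrow> 'a \<Rightarrow> bool) \<Rightarrow> 'a \<Rightarrow> 'a" where
  "Power E x = the_set E (\<lambda>z. subset_of E z x)"

definition is_partition :: "('a \<Rightarrow> 'a \<Rightarrow> bool) \<Rightarrow> 'a \<Rightarrow> 'a \<Rightarrow> bool" where
  "is_partition E p x \<longleftrightarrow>
     (\<forall>s. E s p \<longrightarrow> subset_of E s x \<and> \<not> is_empty E s) \<and>
     (\<forall>s t. E s p \<and> E t p \<and> s \<noteq> t \<longrightarrow> \<not> (\<exists>z. E z s \<and> E z t)) \<and>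
     (\<forall>z. (\<exists>s. E s p \<and> E z s) \<longleftrightarrow> E z x)"

definition Partitions :: "('a \<Rightarrow> 'a \<Rightarrow> bool) \<Rightarrow> 'a \<Rightarrow> 'a" where
  "Partitions E x = the_set E (\<lambda>p. is_partition E p x)"

text \<open>The von Neumann numeral of a standard natural number.\<close>

primrec num :: "('a \<Rightarrow> 'a \<Rightarrow> bool) \<Rightarrow> nat \<Rightarrow> 'a" where
  "num E 0 = the_set E (\<lambda>z. False)"
| "num E (Suc n) = the_set E (\<lambda>z. E z (num E n) \<or> z = num E n)"

text \<open>The natural numbers of the model (which need not be standard).\<close>

definition omega :: "('a \<Rightarrow> 'a \<Rightarrow> bool) \<Rightarrow> 'a" where
  "omega E = the_set E (\<lambda>n. \<forall>w. is_inductive E w \<longrightarrow> E n w)"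

definition is_pair :: "('a \<Rightarrow> 'a \<Rightarrow> bool) \<Rightarrow> 'a \<Rightarrow> 'a \<Rightarrow> 'a \<Rightarrow> bool" where
  "is_pair E p a b \<longleftrightarrow> (\<forall>z. E z p \<longleftrightarrow> z = a \<or> z = b)"

definition is_opair :: "('a \<Rightarrow> 'a \<Rightarrow> bool) \<Rightarrow> 'a \<Rightarrow> 'a \<Rightarrow> 'a \<Rightarrow> bool" where
  "is_opair E p a b \<longleftrightarrow> (\<exists>s t. is_pair E s a a \<and> is_pair E t a b \<and> is_pair E p s t)"

definition maps_to :: "('a \<Rightarrow> 'a \<Rightarrow> bool) \<Rightarrow> 'a \<Rightarrow> 'a \<Rightarrow> 'a \<Rightarrow> bool" where
  "maps_to E f a b \<longleftrightarrow> (\<exists>p. is_opair E p a b \<and> E p f)"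

definition is_function :: "('a \<Rightarrow> 'a \<Rightarrow> bool) \<Rightarrow> 'a \<Rightarrow> 'a \<Rightarrow> 'a \<Rightarrow> bool" where
  "is_function E f x y \<longleftrightarrow>
     (\<forall>p. E p f \<longrightarrow> (\<exists>a b. E a x \<and> E b y \<and> is_opair E p a b)) \<and>
     (\<forall>a. E a x \<longrightarrow> (\<exists>!b. maps_to E f a b))"

definition is_injection :: "('a \<Rightarrow> 'a \<Rightarrow> bool) \<Rightarrow> 'a \<Rightarrow> 'a \<Rightarrow> 'a \<Rightarrow> bool" where
  "is_injection E f x y \<longleftrightarrow>
     is_function E f x y \<and> (\<forall>a a' b. maps_to E f a b \<and> maps_to E f a' b \<longrightarrow> a = a')"

definition is_bijection :: "('a \<Rightarrow> 'a \<Rightarrow> bool) \<Rightarrow> 'a \<Rightarrow> 'a \<Rightarrow> 'a \<Rightarrow> bool" where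
  "is_bijection E f x y \<longleftrightarrow>
     is_injection E f x y \<and> (\<forall>b. E b y \<longrightarrow> (\<exists>a. maps_to E f a b))"

definition equinumerous :: "('a \<Rightarrow> 'a \<Rightarrow> bool) \<Rightarrow> 'a \<Rightarrow> 'a \<Rightarrow> bool" where
  "equinumerous E x y \<longleftrightarrow> (\<exists>f. is_bijection E f x y)"

definition cardinality :: "('a \<Rightarrow> 'a \<Rightarrow> bool) \<Rightarrow> 'a \<Rightarrow> 'a set" where
  "cardinality E x = {y. equinumerous E x y}"

definition is_cardinal :: "('a \<Rightarrow> 'a \<Rightarrow> bool) \<Rightarrow> 'a set \<Rightarrow> bool" where
  "is_cardinal E \<mm> \<longleftrightarrow> (\<exists>x. \<mm> = cardinality E x)"

definition cardinal_le :: "('a \<Rightarrow> 'a \<Rightarrow> bool) \<Rightarrow> 'a set \<Rightarrow> 'a set \<Rightarrow> bool" where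
  "cardinal_le E \<pp> \<qq> \<longleftrightarrow> (\<exists>x\<in>\<pp>. \<exists>y\<in>\<qq>. \<exists>f. is_injection E f x y)"

definition cardinal_less :: "('a \<Rightarrow> 'a \<Rightarrow> bool) \<Rightarrow> 'a set \<Rightarrow> 'a set \<Rightarrow> bool" where
  "cardinal_less E \<pp> \<qq> \<longleftrightarrow> cardinal_le E \<pp> \<qq> \<and> \<pp> \<noteq> \<qq>"

definition fin_card :: "('a \<Rightarrow> 'a \<Rightarrow> bool) \<Rightarrow> nat \<Rightarrow> 'a set" where
  "fin_card E n = cardinality E (num E n)"

definition aleph0 :: "('a \<Rightarrow> 'a \<Rightarrow> bool) \<Rightarrow> 'a set" where
  "aleph0 E = cardinality E (omega E)"

text \<open>
  The union over all sets \<open>m\<close> of cardinality \<open>\<mm>\<close> avoids choosing a representative;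
  the classes united are all equal.
\<close>

definition two_pow :: "('a \<Rightarrow> 'a \<Rightarrow> bool) \<Rightarrow> 'a set \<Rightarrow> 'a set" where
  "two_pow E \<mm> = (\<Union>m\<in>\<mm>. cardinality E (Power E m))"

definition part :: "('a \<Rightarrow> 'a \<Rightarrow> bool) \<Rightarrow> 'a set \<Rightarrow> 'a set" where
  "part E \<mm> = (\<Union>m\<in>\<mm>. cardinality E (Partitions E m))"

lemma extensionality:
  assumes "ZF_model E"
  shows "(\<And>z. E z x \<longleftrightarrow> E z y) \<Longrightarrow> x = y"
  using assms unfolding ZF_model_def by (elim conjE) simp

lemma pairing:
  assumes "ZF_model E"
  shows "\<exists>p. \<forall>z. E z p \<longleftrightarrow> z = x \<or> z = y"
  using assms by (simp add: ZF_model_def)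

lemma union:
  assumes "ZF_model E"
  shows "\<exists>u. \<forall>z. E z u \<longleftrightarrow> (\<exists>y. E y x \<and> E z y)"
  using assms by (simp add: ZF_model_def)

lemma the_set_mem:
  assumes "ZF_model E" and "\<exists>y. \<forall>z. E z y \<longleftrightarrow> P z"
  shows "E z (the_set E P) \<longleftrightarrow> P z"
proof -
  have "\<exists>!y. \<forall>z. E z y \<longleftrightarrow> P z"
    using assms(2) extensionality[OF assms(1)] by metis
  from theI'[OF this] show ?thesis
    unfolding the_set_def by blast
qed

lemma Power_mem:
  assumes "ZF_model E"
  shows "E z (Power E x) \<longleftrightarrow> subset_of E z x"
  unfolding Power_def using assms
  by (rule the_set_mem) (use assms in \<open>simp add: ZF_model_def\<close>)

lemma separation:
  assumes "ZF_model E"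
  shows "\<exists>y. \<forall>z. E z y \<longleftrightarrow> E z x \<and> sat E (v(0 := z)) \<phi>"
  using assms unfolding ZF_model_def by blast

abbreviation Imp :: "fm \<Rightarrow> fm \<Rightarrow> fm" where
  "Imp \<phi> \<psi> \<equiv> Neg (Conj \<phi> (Neg \<psi>))"

definition Iff :: "fm \<Rightarrow> fm \<Rightarrow> fm" where
  "Iff \<phi> \<psi> = Conj (Imp \<phi> \<psi>) (Imp \<psi> \<phi>)"

definition Exists :: "nat \<Rightarrow> fm \<Rightarrow> fm" where
  "Exists i \<phi> = Neg (Forall i (Neg \<phi>))"

lemma sat_Iff [simp]: "sat E v (Iff \<phi> \<psi>) \<longleftrightarrow> (sat E v \<phi> \<longleftrightarrow> sat E v \<psi>)"
  by (auto simp: Iff_def)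

lemma sat_Exists [simp]: "sat E v (Exists i \<phi>) \<longleftrightarrow> (\<exists>x. sat E (v(i := x)) \<phi>)"
  by (simp add: Exists_def)

lemma Partitions_mem:
  assumes "ZF_model E"
  shows "E p (Partitions E x) \<longleftrightarrow> is_partition E p x"
proof -
  let ?\<phi> = "Conj (Forall 2 (Imp (Mem 2 0) (Conj (Forall 3 (Imp (Mem 3 2) (Mem 3 1))) (Exists 3 (Mem 3 2)))))
     (Conj (Forall 2 (Forall 3 (Imp (Conj (Mem 2 0) (Conj (Mem 3 0) (Neg (Eq 2 3))))
              (Neg (Exists 4 (Conj (Mem 4 2) (Mem 4 3)))))))
       (Forall 3 (Iff (Exists 2 (Conj (Mem 2 0) (Mem 3 2))) (Mem 3 1))))"
  have "\<forall>q. sat E ((\<lambda>_. x)(0 := q)) ?\<phi> \<longleftrightarrow> is_partition E q x"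
    unfolding is_partition_def subset_of_def is_empty_def
    by (simp, intro allI conj_cong arg_cong[of _ _ HOL.All] ext refl) auto
  then have "\<exists>\<phi>. \<forall>q. sat E ((\<lambda>_. x)(0 := q)) \<phi> \<longleftrightarrow> is_partition E q x" ..
  then obtain \<phi> where \<phi>: "sat E ((\<lambda>_. x)(0 := q)) \<phi> \<longleftrightarrow> is_partition E q x" for q
    by auto
  have "\<exists>y. \<forall>q. E q y \<longleftrightarrow> E q (Power E (Power E x)) \<and> is_partition E q x"
    using separation[OF assms, of "Power E (Power E x)" "\<lambda>_. x" \<phi>] unfolding \<phi> .
  moreover have "E q (Power E (Power E x))" if "is_partition E q x" for q
  proof -
    have "\<forall>s. E s q \<longrightarrow> subset_of E s x \<and> \<not> is_empty E s"
      using that unfolding is_partition_def by (rule conjunct1)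
    then show ?thesis
      unfolding Power_mem[OF assms] subset_of_def[of E q] by simp
  qed
  ultimately have "\<exists>y. \<forall>q. E q y \<longleftrightarrow> is_partition E q x"
    by (metis (full_types))
  from the_set_mem[OF assms this] show ?thesis
    unfolding Partitions_def .
qed

lemma num_0_mem:
  assumes "ZF_model E"
  shows "\<not> E z (num E 0)"
proof -
  have "\<exists>y. \<forall>z. E z y \<longleftrightarrow> False"
    using separation[OF assms, of undefined "\<lambda>_. undefined" "Neg (Eq 0 0)"] by simp
  from the_set_mem[OF assms this] show ?thesis by simp
qed

lemma num_Suc_mem:
  assumes "ZF_model E"
  shows "E z (num E (Suc n)) \<longleftrightarrow> E z (num E n) \<or> z = num E n"
proof -
  let ?x = "num E n"
  obtain s where s: "\<And>z. E z s \<longleftrightarrow> z = ?x"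
    using pairing[OF assms, of ?x ?x] by auto
  obtain p where p: "\<And>z. E z p \<longleftrightarrow> z = ?x \<or> z = s"
    using pairing[OF assms, of ?x s] by auto
  obtain u where "\<And>z. E z u \<longleftrightarrow> (\<exists>y. E y p \<and> E z y)"
    using union[OF assms, of p] by auto
  then have "\<forall>z. E z u \<longleftrightarrow> E z ?x \<or> z = ?x"
    by (auto simp: s p)
  then have "\<exists>y. \<forall>z. E z y \<longleftrightarrow> E z ?x \<or> z = ?x" ..
  from the_set_mem[OF assms this] show ?thesis by simp
qed

lemma omega_mem:
  assumes "ZF_model E"
  shows "E n (omega E) \<longleftrightarrow> (\<forall>w. is_inductive E w \<longrightarrow> E n w)"
proof -
  let ?ind = "Conj (Exists 2 (Conj (Forall 3 (Neg (Mem 3 2))) (Mem 2 1)))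
     (Forall 2 (Imp (Mem 2 1)
       (Exists 3 (Conj (Forall 4 (Iff (Mem 4 3) (Neg (Conj (Neg (Mem 4 2)) (Neg (Eq 4 2)))))) (Mem 3 1)))))"
  have "sat E v ?ind \<longleftrightarrow> is_inductive E (v 1)" for v
    unfolding is_inductive_def is_succ_def is_empty_def by (simp add: disj_imp)
  then obtain \<iota> where \<iota>: "\<And>v. sat E v \<iota> \<longleftrightarrow> is_inductive E (v 1)"
    by blast
  have "\<exists>w. is_inductive E w"
    using assms by (simp add: ZF_model_def)
  then obtain w where w: "is_inductive E w" ..
  have "\<exists>y. \<forall>z. E z y \<longleftrightarrow> E z w \<and> sat E ((\<lambda>_. w)(0 := z)) (Forall 1 (Imp \<iota> (Mem 0 1)))"
    by (rule separation[OF assms])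
  then have "\<exists>y. \<forall>z. E z y \<longleftrightarrow> E z w \<and> (\<forall>w. is_inductive E w \<longrightarrow> E z w)"
    by (simp add: \<iota>)
  then have "\<exists>y. \<forall>z. E z y \<longleftrightarrow> (\<forall>w. is_inductive E w \<longrightarrow> E z w)"
    using w by metis
  from the_set_mem[OF assms this] show ?thesis
    unfolding omega_def .
qed

end

theory Submission
  imports Defs
begin

text \<open>
  The proof has two parts: an explicit injection of the power set of \<open>m\<close> into the set of
  partitions of \<open>m\<close> that misses a partition, and the remark that, were the two sets
  equinumerous, it would turn into an injective self-map of the power set that is not surjective,
  whose iteration embeds \<open>\<omega>\<close> into the power set, contrary to the hypothesis.

  For the injection, fix five distinct points \<open>a\<^sub>0, \<dots>, a\<^sub>4\<close> of \<open>m\<close>. A set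
  \<open>A\<close> that does not contain \<open>a\<^sub>0\<close> is coded by the partition into \<open>A\<close> and its
  complement (only \<open>m\<close> itself if \<open>A\<close> is empty); \<open>A\<close> can be read off
  as the points not equivalent to \<open>a\<^sub>0\<close>. A set
  that contains \<open>a\<^sub>0\<close> is coded by a partition with one block \<open>C\<close> and singletons
  otherwise. To keep these codes apart from the first kind, \<open>C\<close> must be non-empty and leave out
  at least two points, so that there are at least three blocks. The choice \<open>C = A\<close> achieves
  this unless \<open>A\<close> is \<open>m\<close> or misses a single point \<open>b\<close>. In the latter case
  \<open>C = m - {a\<^sub>0, b}\<close>, which is recognised by \<open>a\<^sub>0 \<notin> C\<close>; for \<open>A = m\<close>
  take \<open>C = {a\<^sub>1, a\<^sub>2}\<close>, which differs from all \<open>m - {a\<^sub>0, b}\<close> because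
  these have at least three elements. The partition whose only other block than singletons is
  \<open>{a\<^sub>1, a\<^sub>3}\<close> is missed (\<open>code_inject\<close>, \<open>code_misses\<close>).

  The combinatorics takes place on HOL sets. It is carried into the model
  (\<open>Power_injects_properly_into_Partitions\<close>) by a notion of definable predicate that is closed
  under the logical connectives, so that Separation applies to a predicate once its syntactic form
  has been decomposed. The embedding of \<open>\<omega>\<close>
  (\<open>omega_injects_if_dedekind_infinite\<close>) needs definability as well: \<open>\<omega>\<close> may be
  non-standard, so recursion and induction along it must be carried out inside the model.
\<close>

section \<open>Definable predicates\<close>

primrec rename :: "(nat \<Rightarrow> nat) \<Rightarrow> fm \<Rightarrow> fm" where
  "rename f (Mem i j) = Mem (f i) (f j)"
| "rename f (Eq i j) = Eq (f i) (f j)"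
| "rename f (Neg \<phi>) = Neg (rename f \<phi>)"
| "rename f (Conj \<phi> \<psi>) = Conj (rename f \<phi>) (rename f \<psi>)"
| "rename f (Forall i \<phi>) = Forall (f i) (rename f \<phi>)"

text \<open>Injectivity prevents capture: the renamed quantifier must not overwrite another variable.\<close>

lemma sat_rename:
  assumes "inj f"
  shows "sat E v (rename f \<phi>) \<longleftrightarrow> sat E (v \<circ> f) \<phi>"
proof (induction \<phi> arbitrary: v)
  case (Forall i \<phi>)
  have "(v(f i := x)) \<circ> f = (v \<circ> f)(i := x)" for x
    using assms by (auto simp: fun_eq_iff inj_eq)
  with Forall show ?case by (simp only: rename.simps sat.simps)
qed simp_all

definition interleave :: "(nat \<Rightarrow> 'a) \<Rightarrow> (nat \<Rightarrow> 'a) \<Rightarrow> nat \<Rightarrow> 'a" where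
  "interleave v w k = (if even k then v (k div 2) else w (k div 2))"

locale zf =
  fixes E :: "'a \<Rightarrow> 'a \<Rightarrow> bool"
  assumes ZF: "ZF_model E"
begin

text \<open>Definability of a predicate of an environment \<open>v\<close> by a formula with parameters \<open>w\<close>. The
  even variables hold \<open>v\<close> and the odd ones \<open>w\<close>; there is thus always room for further
  parameters and for bound variables.\<close>

definition definable :: "((nat \<Rightarrow> 'a) \<Rightarrow> bool) \<Rightarrow> bool" where
  "definable P \<longleftrightarrow> (\<exists>\<phi> w. \<forall>v. P v \<longleftrightarrow> sat E (interleave v w) \<phi>)"

text \<open>The atomic terms of the language with parameters. Decomposition rules stated for them also apply
  below quantifiers, where the variable \<open>v i\<close> becomes \<open>v (Suc i)\<close>.\<close>

definition simple_term :: "((nat \<Rightarrow> 'a) \<Rightarrow> 'a) \<Rightarrow> bool" where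
  "simple_term t \<longleftrightarrow> (\<exists>i. t = (\<lambda>v. v i)) \<or> (\<exists>c. t = (\<lambda>v. c))"

lemma simple_term_var: "simple_term (\<lambda>v. v i)"
  by (auto simp: simple_term_def)

lemma simple_term_const: "simple_term (\<lambda>v. c)"
  by (auto simp: simple_term_def)

lemma simple_termE:
  assumes "simple_term t"
  obtains i where "t = (\<lambda>v. v i)" | c where "t = (\<lambda>v. c)"
  using assms by (auto simp: simple_term_def)

text \<open>Any constants of an atomic formula are supplied by the parameters \<open>w\<close>, at most two of them.\<close>

lemma simple_term_slots:
  assumes "simple_term t" "simple_term u"
  obtains i j w where "\<And>v. t v = interleave v w i" "\<And>v. u v = interleave v w j"
proof -
  have slot: "\<exists>i. \<forall>v. t v = interleave v w i"
    if t: "simple_term t" and w: "\<And>c. t = (\<lambda>v. c) \<Longrightarrow> \<exists>k. w k = c" for t w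
    using t
  proof (cases rule: simple_termE)
    case (1 i)
    then have "\<forall>v. t v = interleave v w (2 * i)" by (simp add: interleave_def)
    then show ?thesis ..
  next
    case (2 c)
    from w[OF 2] obtain k where "w k = c" ..
    with 2 have "\<forall>v. t v = interleave v w (2 * k + 1)" by (simp add: interleave_def)
    then show ?thesis ..
  qed
  let ?w = "\<lambda>k. if k = 0 then t undefined else u undefined"
  have "\<exists>i. \<forall>v. t v = interleave v ?w i"
    by (rule slot[OF assms(1)]) (auto intro!: exI[of _ 0])
  moreover have "\<exists>j. \<forall>v. u v = interleave v ?w j"
    by (rule slot[OF assms(2)]) (auto intro!: exI[of _ 1])
  ultimately show thesis using that by blast
qed

lemma definable_mem:
  assumes "simple_term t" "simple_term u"
  shows "definable (\<lambda>v. E (t v) (u v))"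
proof -
  obtain i j w where "\<And>v. t v = interleave v w i" "\<And>v. u v = interleave v w j"
    by (rule simple_term_slots[OF assms]) blast
  then have "\<forall>v. E (t v) (u v) \<longleftrightarrow> sat E (interleave v w) (Mem i j)" by simp
  then show ?thesis unfolding definable_def by blast
qed

lemma definable_eq:
  assumes "simple_term t" "simple_term u"
  shows "definable (\<lambda>v. t v = u v)"
proof -
  obtain i j w where "\<And>v. t v = interleave v w i" "\<And>v. u v = interleave v w j"
    by (rule simple_term_slots[OF assms]) blast
  then have "\<forall>v. t v = u v \<longleftrightarrow> sat E (interleave v w) (Eq i j)" by simp
  then show ?thesis unfolding definable_def by blast
qed

lemma definable_not:
  assumes "definable P"
  shows "definable (\<lambda>v. \<not> P v)"
proof -
  obtain \<phi> w where "\<And>v. P v \<longleftrightarrow> sat E (interleave v w) \<phi>"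
    using assms unfolding definable_def by blast
  then have "\<forall>v. \<not> P v \<longleftrightarrow> sat E (interleave v w) (Neg \<phi>)" by simp
  then show ?thesis unfolding definable_def by blast
qed

text \<open>The parameters of both formulas are kept by interleaving them once more; the shared variables stay
  in the even positions.\<close>

lemma definable_conj:
  assumes "definable P" "definable Q"
  shows "definable (\<lambda>v. P v \<and> Q v)"
proof -
  obtain \<phi> w where P: "\<And>v. P v \<longleftrightarrow> sat E (interleave v w) \<phi>"
    using assms(1) unfolding definable_def by blast
  obtain \<psi> u where Q: "\<And>v. Q v \<longleftrightarrow> sat E (interleave v u) \<psi>"
    using assms(2) unfolding definable_def by blast
  let ?f = "\<lambda>k::nat. if even k then k else 4 * (k div 2) + 1"
  let ?g = "\<lambda>k::nat. if even k then k else 4 * (k div 2) + 3"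
  have injs: "inj ?f" "inj ?g"
    by (rule injI; simp split: if_splits; presburger)+
  have f: "interleave v (interleave w u) \<circ> ?f = interleave v w" for v
    by (auto simp: fun_eq_iff interleave_def elim!: oddE)
  have g: "interleave v (interleave w u) \<circ> ?g = interleave v u" for v
  proof
    fix k
    have "(4 * l + 3) div 2 = 2 * l + 1" for l :: nat by presburger
    then show "(interleave v (interleave w u) \<circ> ?g) k = interleave v u k"
      by (auto simp: interleave_def)
  qed
  have "\<forall>v. P v \<and> Q v \<longleftrightarrow>
      sat E (interleave v (interleave w u)) (Conj (rename ?f \<phi>) (rename ?g \<psi>))"
    using P Q by (simp only: sat.simps sat_rename[OF injs(1)] sat_rename[OF injs(2)] f g) simp
  then show ?thesis unfolding definable_def by blast
qed

text \<open>The environment is shifted as for de Bruijn indices, with the bound variable at index 0. The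
  formula moves that variable to the odd position 1 and each parameter one odd position up.\<close>

lemma definable_all:
  assumes "definable (\<lambda>v. P (\<lambda>n. v (Suc n)) (v 0))"
  shows "definable (\<lambda>v. \<forall>x. P v x)"
proof -
  obtain \<phi> w where P: "\<And>v. P (\<lambda>n. v (Suc n)) (v 0) \<longleftrightarrow> sat E (interleave v w) \<phi>"
    using assms unfolding definable_def by blast
  let ?f = "\<lambda>k::nat. if k = 0 then 1 else if even k then k - 2 else k + 2"
  let ?w = "\<lambda>k. w (k - 1)"
  have inj: "inj ?f"
    by (rule injI; simp split: if_splits; presburger)
  have env: "(interleave v ?w)(1 := x) \<circ> ?f = interleave (case_nat x v) w" for v x
  proof
    fix k
    have "k = 0 \<or> (\<exists>l. k = 2 * Suc l) \<or> (\<exists>l. k = 2 * l + 1)" by presburger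
    then show "((interleave v ?w)(1 := x) \<circ> ?f) k = interleave (case_nat x v) w k"
      by (auto simp: interleave_def)
  qed
  have "P v x \<longleftrightarrow> sat E (interleave (case_nat x v) w) \<phi>" for v x
    using P[of "case_nat x v"] by simp
  then have "\<forall>v. (\<forall>x. P v x) \<longleftrightarrow> sat E (interleave v ?w) (Forall 1 (rename ?f \<phi>))"
    by (simp only: sat.simps sat_rename[OF inj] env) simp
  then show ?thesis unfolding definable_def by blast
qed

lemma definable_disj:
  assumes "definable P" "definable Q"
  shows "definable (\<lambda>v. P v \<or> Q v)"
  using definable_not[OF definable_conj[OF definable_not[OF assms(1)] definable_not[OF assms(2)]]]
  by simp

lemma definable_imp:
  assumes "definable P" "definable Q"
  shows "definable (\<lambda>v. P v \<longrightarrow> Q v)"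
  using definable_disj[OF definable_not[OF assms(1)] assms(2)] by (simp only: imp_conv_disj)

lemma definable_iff:
  assumes "definable P" "definable Q"
  shows "definable (\<lambda>v. P v \<longleftrightarrow> Q v)"
  using definable_conj[OF definable_imp[OF assms] definable_imp[OF assms(2,1)]]
  by (simp only: iff_conv_conj_imp)

lemma definable_ex:
  assumes "definable (\<lambda>v. P (\<lambda>n. v (Suc n)) (v 0))"
  shows "definable (\<lambda>v. \<exists>x. P v x)"
  using definable_not[OF definable_all[where P = "\<lambda>v x. \<not> P v x", OF definable_not[OF assms]]]
  by simp

lemmas definable_logic =
  simple_term_var simple_term_const definable_mem definable_eq definable_not definable_conj
  definable_disj definable_imp definable_iff definable_all definable_ex

lemma definable_is_succ:
  "simple_term t \<Longrightarrow> simple_term u \<Longrightarrow> definable (\<lambda>v. is_succ E (t v) (u v))"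
  unfolding is_succ_def by (elim simple_termE; hypsubst; intro definable_logic)

lemma definable_is_pair:
  "simple_term t \<Longrightarrow> simple_term u \<Longrightarrow> simple_term w \<Longrightarrow>
    definable (\<lambda>v. is_pair E (t v) (u v) (w v))"
  unfolding is_pair_def by (elim simple_termE; hypsubst; intro definable_logic)

lemma definable_is_opair:
  "simple_term t \<Longrightarrow> simple_term u \<Longrightarrow> simple_term w \<Longrightarrow>
    definable (\<lambda>v. is_opair E (t v) (u v) (w v))"
  unfolding is_opair_def
  by (elim simple_termE; hypsubst; intro definable_logic definable_is_pair)

lemma definable_maps_to:
  "simple_term t \<Longrightarrow> simple_term u \<Longrightarrow> simple_term w \<Longrightarrow>
    definable (\<lambda>v. maps_to E (t v) (u v) (w v))"
  unfolding maps_to_def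
  by (elim simple_termE; hypsubst; intro definable_logic definable_is_opair)

lemmas definable_intros =
  definable_logic definable_is_succ definable_is_opair definable_maps_to

lemma comprehension:
  assumes "definable (\<lambda>v. P (v 0))"
  shows "\<exists>y. \<forall>z. E z y \<longleftrightarrow> E z x \<and> P z"
proof -
  obtain \<phi> w where P: "\<And>v. P (v 0) \<longleftrightarrow> sat E (interleave v w) \<phi>"
    using assms unfolding definable_def by blast
  have env: "(interleave (\<lambda>_. x) w)(0 := z) = interleave ((\<lambda>_. x)(0 := z)) w" for z
    by (auto simp: fun_eq_iff interleave_def)
  have "sat E ((interleave (\<lambda>_. x) w)(0 := z)) \<phi> \<longleftrightarrow> P z" for z
    unfolding env P[symmetric] by simp
  with separation[OF ZF, of x "interleave (\<lambda>_. x) w" \<phi>] show ?thesis by simp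
qed

text \<open>The instance \<open>R (t v) (u v)\<close> is expressed as
  \<open>\<exists>y x. x = t v \<and> y = u v \<and> R x y\<close>. The bound variables come in this order because the
  innermost one has index 0, the index at which the first argument of \<open>R\<close> is assumed.\<close>

lemma definable_subst2:
  assumes "definable (\<lambda>v. R (v 0) (v 1))" "simple_term t" "simple_term u"
  shows "definable (\<lambda>v. R (t v) (u v))"
proof -
  have R: "definable (\<lambda>v. R (v 0) (v (Suc 0)))"
    using assms(1) by simp
  have "definable (\<lambda>v. \<exists>y x. x = t v \<and> y = u v \<and> R x y)"
    using assms(2,3) by (elim simple_termE; hypsubst; intro definable_intros R)
  then show ?thesis by simp
qed

section \<open>Ordered pairs and functions given by definable relations\<close>

lemma is_opair_exists: "\<exists>p. is_opair E p a b"
proof -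
  obtain s where s: "is_pair E s a a"
    using pairing[OF ZF, of a a] by (auto simp: is_pair_def)
  obtain t where t: "is_pair E t a b"
    using pairing[OF ZF, of a b] by (auto simp: is_pair_def)
  obtain p where "is_pair E p s t"
    using pairing[OF ZF, of s t] by (auto simp: is_pair_def)
  with s t show ?thesis unfolding is_opair_def by blast
qed

lemma is_pair_unique: "is_pair E p a b \<Longrightarrow> is_pair E q a b \<Longrightarrow> p = q"
  by (rule extensionality[OF ZF]) (simp add: is_pair_def)

lemma is_opair_unique: "is_opair E p a b \<Longrightarrow> is_opair E q a b \<Longrightarrow> p = q"
  unfolding is_opair_def by (metis is_pair_unique)

lemma is_opair_inject:
  assumes "is_opair E p a b" "is_opair E p c d"
  shows "a = c \<and> b = d"
proof -
  obtain s t where s: "is_pair E s a a" and t: "is_pair E t a b" and p: "is_pair E p s t"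
    using assms(1) unfolding is_opair_def by blast
  obtain s' t' where s': "is_pair E s' c c" and t': "is_pair E t' c d" and p': "is_pair E p s' t'"
    using assms(2) unfolding is_opair_def by blast
  have st: "(z = s \<or> z = t) \<longleftrightarrow> (z = s' \<or> z = t')" for z
    using p p' by (simp add: is_pair_def)
  have "a = c"
    using st[of s] s s' t' unfolding is_pair_def by metis
  moreover have "b = d"
    using st[of t] st[of t'] s t s' t' \<open>a = c\<close> unfolding is_pair_def by metis
  ultimately show ?thesis ..
qed

lemma maps_to_opair: "is_opair E p a b \<Longrightarrow> maps_to E f a b \<longleftrightarrow> E p f"
  unfolding maps_to_def using is_opair_unique by blast

text \<open>The product \<open>x \<times> y\<close> lies in the double power set of \<open>x \<union> y\<close>, so a definable relation
  between \<open>x\<close> and \<open>y\<close> can be separated from it.\<close>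

lemma definable_relation_exists:
  assumes "definable (\<lambda>v. R (v 0) (v 1))"
  shows "\<exists>f. (\<forall>p. E p f \<longrightarrow> (\<exists>a b. E a x \<and> E b y \<and> is_opair E p a b)) \<and>
    (\<forall>a b. maps_to E f a b \<longleftrightarrow> E a x \<and> E b y \<and> R a b)"
proof -
  obtain c where c: "is_pair E c x y"
    using pairing[OF ZF, of x y] by (auto simp: is_pair_def)
  obtain u where "\<And>z. E z u \<longleftrightarrow> (\<exists>d. E d c \<and> E z d)"
    using union[OF ZF, of c] by blast
  with c have u: "E z u \<longleftrightarrow> E z x \<or> E z y" for z by (auto simp: is_pair_def)
  have bound: "E p (Power E (Power E u))" if "is_opair E p a b" "E a x" "E b y" for p a b
    using that unfolding Power_mem[OF ZF] is_opair_def is_pair_def subset_of_def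
    by (auto simp: Power_mem[OF ZF] subset_of_def u)
  \<comment> \<open>\<open>Q\<close> is kept opaque so that Separation is applied to it as a whole\<close>
  obtain Q where Q: "Q = (\<lambda>p. \<exists>a b. is_opair E p a b \<and> E a x \<and> E b y \<and> R a b)" by blast
  have "definable (\<lambda>v. \<exists>a b. is_opair E (v 0) a b \<and> E a x \<and> E b y \<and> R a b)"
    by (intro definable_intros definable_subst2[OF assms])
  then have "definable (\<lambda>v. Q (v 0))" by (simp only: Q)
  from comprehension[OF this] obtain f
    where "\<And>p. E p f \<longleftrightarrow> E p (Power E (Power E u)) \<and> Q p" by blast
  with bound have f: "E p f \<longleftrightarrow> (\<exists>a b. is_opair E p a b \<and> E a x \<and> E b y \<and> R a b)" for p
    unfolding Q by blast
  have "maps_to E f a b \<longleftrightarrow> E a x \<and> E b y \<and> R a b" for a b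
  proof -
    obtain p where p: "is_opair E p a b" using is_opair_exists by blast
    show ?thesis
      unfolding maps_to_opair[OF p] f using p is_opair_inject[OF p] by blast
  qed
  then show ?thesis using f by blast
qed


lemma definable_function_exists:
  assumes "definable (\<lambda>v. R (v 0) (v 1))"
    and "\<And>a. E a x \<Longrightarrow> \<exists>!b. E b y \<and> R a b"
  obtains f where "is_function E f x y" "\<And>a b. maps_to E f a b \<longleftrightarrow> E a x \<and> E b y \<and> R a b"
proof -
  obtain f where f: "\<forall>p. E p f \<longrightarrow> (\<exists>a b. E a x \<and> E b y \<and> is_opair E p a b)"
      "\<And>a b. maps_to E f a b \<longleftrightarrow> E a x \<and> E b y \<and> R a b"
    using definable_relation_exists[OF assms(1)] by blast
  then have "is_function E f x y"
    unfolding is_function_def f(2) using assms(2) by blast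
  with f(2) show thesis using that by blast
qed

lemma is_function_dom_cod:
  assumes "is_function E f x y" "maps_to E f a b"
  shows "E a x" "E b y"
proof -
  obtain p where p: "is_opair E p a b" "E p f"
    using assms(2) unfolding maps_to_def by blast
  then obtain c d where "E c x" "E d y" "is_opair E p c d"
    using assms(1) unfolding is_function_def by blast
  with is_opair_inject[OF p(1)] show "E a x" "E b y" by auto
qed

lemma is_function_unique:
  assumes "is_function E f x y" "maps_to E f a b" "maps_to E f a c"
  shows "b = c"
proof -
  have "\<exists>!b. maps_to E f a b"
    using is_function_dom_cod(1)[OF assms(1,2)] assms(1) unfolding is_function_def by blast
  with assms(2,3) show ?thesis by blast
qed

lemma is_function_total:
  "is_function E f x y \<Longrightarrow> E a x \<Longrightarrow> \<exists>b. maps_to E f a b"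
  unfolding is_function_def by blast

lemma equinumerous_refl: "equinumerous E x x"
proof -
  have "definable (\<lambda>v. v 0 = v 1)" by (intro definable_intros)
  then obtain f where "is_function E f x x" "\<And>a b. maps_to E f a b \<longleftrightarrow> E a x \<and> E b x \<and> a = b"
    by (rule definable_function_exists[where x = x and y = x]) auto
  then show ?thesis
    unfolding equinumerous_def is_bijection_def is_injection_def by auto
qed

lemma cardinality_self: "x \<in> cardinality E x"
  by (simp add: cardinality_def equinumerous_refl)

section \<open>A Dedekind-infinite set contains a copy of the natural numbers\<close>

lemma omega_zero: "E (num E 0) (omega E)"
  unfolding omega_mem[OF ZF]
proof (intro allI impI)
  fix w assume "is_inductive E w"
  then obtain e where "is_empty E e" "E e w" unfolding is_inductive_def by blast
  moreover have "e = num E 0"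
    using \<open>is_empty E e\<close> num_0_mem[OF ZF] by (intro extensionality[OF ZF]) (simp add: is_empty_def)
  ultimately show "E (num E 0) w" by simp
qed

lemma is_succ_unique: "is_succ E s x \<Longrightarrow> is_succ E t x \<Longrightarrow> s = t"
  by (rule extensionality[OF ZF]) (simp add: is_succ_def)

lemma is_succ_nonzero: "\<not> is_succ E (num E 0) x"
  unfolding is_succ_def using num_0_mem[OF ZF] by blast

lemma mem_asym: "\<not> (E x y \<and> E y x)"
proof
  assume *: "E x y \<and> E y x"
  obtain p where p: "\<And>z. E z p \<longleftrightarrow> z = x \<or> z = y"
    using pairing[OF ZF] by blast
  have "\<forall>x. (\<exists>y. E y x) \<longrightarrow> (\<exists>y. E y x \<and> \<not> (\<exists>z. E z x \<and> E z y))"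
    using ZF unfolding ZF_model_def by (elim conjE)
  moreover have "E x p" "E y p" using p by simp_all
  ultimately obtain w where "E w p" "\<not> E x w" "\<not> E y w" by metis
  with p * show False by auto
qed

text \<open>If \<open>x \<noteq> y\<close> had the same successor, then \<open>x \<in> y\<close> and \<open>y \<in> x\<close>, against Foundation.\<close>

lemma is_succ_inject:
  assumes "is_succ E s x" "is_succ E s y"
  shows "x = y"
  using assms mem_asym[of x y] unfolding is_succ_def by blast

lemma omega_succ:
  assumes "E n (omega E)"
  shows "\<exists>s. is_succ E s n \<and> E s (omega E)"
proof -
  have mem: "\<exists>s. is_succ E s n \<and> E s w" if "is_inductive E w" for w
    using assms that unfolding omega_mem[OF ZF] is_inductive_def by blast
  obtain w where "is_inductive E w"
    using ZF unfolding ZF_model_def by (elim conjE exE)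
  with mem obtain s where "is_succ E s n" by blast
  with mem is_succ_unique have "E s w" if "is_inductive E w" for w
    using that by blast
  with \<open>is_succ E s n\<close> show ?thesis unfolding omega_mem[OF ZF] by blast
qed

lemma omega_induct:
  assumes "definable (\<lambda>v. P (v 0))" "E n (omega E)" "P (num E 0)"
    and step: "\<And>k s. E k (omega E) \<Longrightarrow> P k \<Longrightarrow> is_succ E s k \<Longrightarrow> P s"
  shows "P n"
proof -
  obtain w where w: "\<And>z. E z w \<longleftrightarrow> E z (omega E) \<and> P z"
    using comprehension[OF assms(1), of "omega E"] by blast
  have "is_inductive E w"
    unfolding is_inductive_def
  proof (intro conjI allI impI)
    show "\<exists>e. is_empty E e \<and> E e w"
      using num_0_mem[OF ZF] omega_zero assms(3) w unfolding is_empty_def by blast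
    show "\<exists>s. is_succ E s k \<and> E s w" if "E k w" for k
      using that omega_succ step w by blast
  qed
  with assms(2) w show ?thesis unfolding omega_mem[OF ZF] by blast
qed

text \<open>The orbit \<open>a, h a, h (h a), \<dots>\<close> of a point outside the range of \<open>h\<close> does not repeat. Its
  graph \<open>G\<close> is obtained without iterating: it is the least relation that contains \<open>(0, a)\<close>
  and is closed under \<open>(k, y) \<mapsto> (k + 1, h y)\<close>. That \<open>G\<close> is an injective function
  follows by induction on \<open>\<omega>\<close>, comparing the last steps of two derivations.\<close>

lemma omega_injects_if_dedekind_infinite:
  assumes h: "is_injection E h x x" and a: "E a x" and miss: "\<And>b. \<not> maps_to E h b a"
  shows "\<exists>f. is_injection E f (omega E) x"
proof -
  have fun_h: "is_function E h x x"
    and inj_h: "\<And>b c d. maps_to E h b d \<Longrightarrow> maps_to E h c d \<Longrightarrow> b = c"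
    using h unfolding is_injection_def by blast+
  define closed where "closed r \<longleftrightarrow> maps_to E r (num E 0) a \<and>
    (\<forall>k y s z. maps_to E r k y \<and> is_succ E s k \<and> maps_to E h y z \<longrightarrow> maps_to E r s z)" for r
  define G where "G n y \<longleftrightarrow> (\<forall>r. closed r \<longrightarrow> maps_to E r n y)" for n y
  have def_G: "definable (\<lambda>v. G (v 0) (v 1))"
    unfolding G_def closed_def by (intro definable_intros)
  note definable_G = definable_subst2[OF def_G]
  have G_zero: "G (num E 0) a"
    unfolding G_def closed_def by blast
  have G_step: "G s z" if "G k y" "is_succ E s k" "maps_to E h y z" for k y s z
    using that unfolding G_def closed_def by blast
  \<comment> \<open>Leastness gives induction along \<open>G\<close>: the pairs of \<open>G\<close> in \<open>\<omega> \<times> x\<close> with property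
     \<open>R\<close> form a closed set of the model.\<close>
  have G_induct: "E n (omega E) \<and> E y x \<and> R n y"
    if def_R: "definable (\<lambda>v. R (v 0) (v 1))" and G: "G n y" and zero: "R (num E 0) a"
      and step: "\<And>k y s z. R k y \<Longrightarrow> G k y \<Longrightarrow> is_succ E s k \<Longrightarrow> maps_to E h y z \<Longrightarrow> R s z"
    for R n y
  proof -
    have "definable (\<lambda>v. G (v 0) (v 1) \<and> R (v 0) (v 1))"
      by (intro definable_intros def_G def_R)
    from definable_relation_exists[where R = "\<lambda>a b. G a b \<and> R a b", OF this]
    obtain r where r: "\<And>n y. maps_to E r n y \<longleftrightarrow> E n (omega E) \<and> E y x \<and> G n y \<and> R n y"
      by blast
    have "closed r"
      unfolding closed_def
    proof (intro conjI allI impI)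
      show "maps_to E r (num E 0) a" using r omega_zero a zero G_zero by blast
      fix k y s z
      assume *: "maps_to E r k y \<and> is_succ E s k \<and> maps_to E h y z"
      have "E s (omega E)" using * r omega_succ is_succ_unique by blast
      moreover have "E z x" using * is_function_dom_cod[OF fun_h] by blast
      ultimately show "maps_to E r s z" using * r step G_step by blast
    qed
    with G r show ?thesis unfolding G_def by blast
  qed
  have G_cases: "(n = num E 0 \<and> y = a) \<or> (\<exists>k z. G k z \<and> is_succ E n k \<and> maps_to E h z y)"
    if "G n y" for n y
  proof -
    let ?R = "\<lambda>n y. (n = num E 0 \<and> y = a) \<or> (\<exists>k z. G k z \<and> is_succ E n k \<and> maps_to E h z y)"
    have "definable (\<lambda>v. ?R (v 0) (v 1))"
      by (intro definable_intros definable_G)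
    from G_induct[where R = ?R, OF this that] show ?thesis by blast
  qed
  \<comment> \<open>the trivial property, for the domain and range that \<open>G_induct\<close> provides\<close>
  have G_dom: "E n (omega E)" "E y x" if "G n y" for n y
    using G_induct[where R = "\<lambda>_ _. a = a", OF _ that] definable_eq[OF simple_term_const simple_term_const]
    by blast+
  have total: "\<exists>y. G n y" if "E n (omega E)" for n
  proof (rule omega_induct[where P = "\<lambda>n. \<exists>y. G n y", OF _ that])
    show "definable (\<lambda>v. \<exists>y. G (v 0) y)" by (intro definable_intros definable_G)
    show "\<exists>y. G (num E 0) y" using G_zero ..
    show "\<exists>y. G s y" if "\<exists>y. G k y" "is_succ E s k" for k s
      using that G_step G_dom is_function_total[OF fun_h] by blast
  qed
  have unique: "\<forall>y z. G n y \<and> G n z \<longrightarrow> y = z" if "E n (omega E)" for n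
  proof (rule omega_induct[where P = "\<lambda>n. \<forall>y z. G n y \<and> G n z \<longrightarrow> y = z", OF _ that])
    show "definable (\<lambda>v. \<forall>y z. G (v 0) y \<and> G (v 0) z \<longrightarrow> y = z)"
      by (intro definable_intros definable_G)
    show "\<forall>y z. G (num E 0) y \<and> G (num E 0) z \<longrightarrow> y = z"
      using G_cases is_succ_nonzero by blast
    fix k s
    assume IH: "\<forall>y z. G k y \<and> G k z \<longrightarrow> y = z" and s: "is_succ E s k"
    have pre: "\<exists>y'. G k y' \<and> maps_to E h y' y" if "G s y" for y
      using G_cases[OF that] s is_succ_nonzero is_succ_inject by blast
    show "\<forall>y z. G s y \<and> G s z \<longrightarrow> y = z"
      using pre IH is_function_unique[OF fun_h] by metis
  qed
  have injective: "\<forall>n' y. G n y \<and> G n' y \<longrightarrow> n = n'" if "E n (omega E)" for n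
  proof (rule omega_induct[where P = "\<lambda>n. \<forall>n' y. G n y \<and> G n' y \<longrightarrow> n = n'", OF _ that])
    show "definable (\<lambda>v. \<forall>n' y. G (v 0) y \<and> G n' y \<longrightarrow> v 0 = n')"
      by (intro definable_intros definable_G)
    show "\<forall>n' y. G (num E 0) y \<and> G n' y \<longrightarrow> num E 0 = n'"
      using G_cases is_succ_nonzero miss by blast
    fix k s
    assume IH: "\<forall>n' y. G k y \<and> G n' y \<longrightarrow> k = n'" and s: "is_succ E s k"
    show "\<forall>n' y. G s y \<and> G n' y \<longrightarrow> s = n'"
    proof (intro allI impI)
      fix n' y assume "G s y \<and> G n' y"
      then have Gs: "G s y" and Gn: "G n' y" by auto
      obtain z where z: "G k z" "maps_to E h z y"
        using G_cases[OF Gs] s is_succ_nonzero is_succ_inject by blast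
      then obtain k' z' where k': "G k' z'" "is_succ E n' k'" "maps_to E h z' y"
        using G_cases[OF Gn] miss by blast
      from z k' have "z' = z" using inj_h by blast
      with z k' IH have "k = k'" by blast
      with s k' show "s = n'" using is_succ_unique by blast
    qed
  qed
  have "\<exists>!y. E y x \<and> G n y" if "E n (omega E)" for n
    using total[OF that] unique[OF that] G_dom by blast
  from definable_function_exists[where x = "omega E" and y = x, OF def_G this]
  obtain f where "is_function E f (omega E) x"
      "\<And>n y. maps_to E f n y \<longleftrightarrow> E n (omega E) \<and> E y x \<and> G n y"
    by blast
  with injective show ?thesis unfolding is_injection_def by blast
qed

section \<open>Quotients in the model\<close>

definition quotient :: "'a \<Rightarrow> ('a \<Rightarrow> 'a \<Rightarrow> bool) \<Rightarrow> 'a" where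
  "quotient m R = the_set E (\<lambda>s. \<exists>x. E x m \<and> (\<forall>z. E z s \<longleftrightarrow> E z m \<and> R x z))"

lemma mem_quotient:
  assumes "definable (\<lambda>v. R (v 0) (v 1))"
  shows "E s (quotient m R) \<longleftrightarrow> (\<exists>x. E x m \<and> (\<forall>z. E z s \<longleftrightarrow> E z m \<and> R x z))"
proof -
  let ?C = "\<lambda>s. \<exists>x. E x m \<and> (\<forall>z. E z s \<longleftrightarrow> E z m \<and> R x z)"
  have "definable (\<lambda>v. ?C (v 0))"
    by (intro definable_intros definable_subst2[OF assms])
  from comprehension[where P = ?C, OF this, of "Power E m"]
  obtain q where "\<forall>s. E s q \<longleftrightarrow> subset_of E s m \<and> ?C s"
    unfolding Power_mem[OF ZF] by blast
  then have "\<forall>s. E s q \<longleftrightarrow> ?C s"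
    unfolding subset_of_def by blast
  then show ?thesis
    unfolding quotient_def by (intro the_set_mem[OF ZF]) blast
qed

lemma eq_class_exists:
  assumes "definable (\<lambda>v. R (v 0) (v 1))"
  shows "\<exists>s. \<forall>z. E z s \<longleftrightarrow> E z m \<and> R x z"
  by (rule comprehension) (intro definable_intros definable_subst2[OF assms])

text \<open>Partitions are obtained from equivalence relations, which are easier to define and to compare.
  The relation need not be a set of the model, only definable.\<close>

lemma is_partition_quotient:
  assumes "definable (\<lambda>v. R (v 0) (v 1))" "equivp R"
  shows "is_partition E (quotient m R) m"
  unfolding is_partition_def mem_quotient[OF assms(1)]
proof (intro conjI allI impI)
  note refl = equivp_reflp[OF assms(2)] and sym = equivp_symp[OF assms(2)]
    and trans = equivp_transp[OF assms(2)]
  fix s assume s: "\<exists>x. E x m \<and> (\<forall>z. E z s \<longleftrightarrow> E z m \<and> R x z)"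
  then show "subset_of E s m" by (auto simp: subset_of_def)
  from s show "\<not> is_empty E s" unfolding is_empty_def using refl by blast
next
  note refl = equivp_reflp[OF assms(2)] and sym = equivp_symp[OF assms(2)]
    and trans = equivp_transp[OF assms(2)]
  fix s t
  assume st: "(\<exists>x. E x m \<and> (\<forall>z. E z s \<longleftrightarrow> E z m \<and> R x z)) \<and>
    (\<exists>x. E x m \<and> (\<forall>z. E z t \<longleftrightarrow> E z m \<and> R x z)) \<and> s \<noteq> t"
  then obtain x y where x: "\<And>z. E z s \<longleftrightarrow> E z m \<and> R x z" and y: "\<And>z. E z t \<longleftrightarrow> E z m \<and> R y z"
    by blast
  show "\<not> (\<exists>z. E z s \<and> E z t)"
  proof
    assume "\<exists>z. E z s \<and> E z t"
    then have "R x y" using x y sym trans by blast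
    then have "E z s \<longleftrightarrow> E z t" for z using x y sym trans by blast
    then have "s = t" by (rule extensionality[OF ZF])
    with st show False by blast
  qed
next
  fix z
  obtain s where "\<And>y. E y s \<longleftrightarrow> E y m \<and> R z y"
    using eq_class_exists[OF assms(1)] by blast
  then show "(\<exists>s. (\<exists>x. E x m \<and> (\<forall>z. E z s \<longleftrightarrow> E z m \<and> R x z)) \<and> E z s) \<longleftrightarrow> E z m"
    using equivp_reflp[OF assms(2)] by blast
qed

lemma quotient_inject:
  assumes R: "definable (\<lambda>v. R (v 0) (v 1))" "equivp R"
    and S: "definable (\<lambda>v. S (v 0) (v 1))" "equivp S"
    and eq: "quotient m R = quotient m S" and "E x m" "E y m"
  shows "R x y \<longleftrightarrow> S x y"
proof -
  obtain s where s: "\<And>z. E z s \<longleftrightarrow> E z m \<and> R x z"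
    using eq_class_exists[OF R(1)] by blast
  then have "E s (quotient m S)"
    unfolding eq[symmetric] mem_quotient[OF R(1)] using \<open>E x m\<close> by blast
  then obtain u where u: "\<And>z. E z s \<longleftrightarrow> E z m \<and> S u z"
    unfolding mem_quotient[OF S(1)] by blast
  have "S u x" using s u \<open>E x m\<close> equivp_reflp[OF R(2)] by blast
  then have "S u y \<longleftrightarrow> S x y"
    using equivp_symp[OF S(2)] equivp_transp[OF S(2)] by blast
  then show ?thesis using s u \<open>E y m\<close> by blast
qed

end

section \<open>Coding subsets by equivalence relations\<close>

locale five_points =
  fixes M :: "'a set" and a0 a1 a2 a3 a4 :: 'a
  assumes points: "a0 \<in> M" "a1 \<in> M" "a2 \<in> M" "a3 \<in> M" "a4 \<in> M"
    and distinct: "distinct [a0, a1, a2, a3, a4]"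
begin

text \<open>The equivalence relation whose only class with more than one element is \<open>C\<close>, or equality if
  \<open>C\<close> has at most one element.\<close>

definition glue :: "'a set \<Rightarrow> 'a \<Rightarrow> 'a \<Rightarrow> bool" where
  "glue C x y \<longleftrightarrow> x = y \<or> x \<in> C \<and> y \<in> C"

text \<open>The block \<open>C\<close> that codes a set \<open>A\<close> with \<open>a\<^sub>0 \<in> A \<subseteq> M\<close>. It is written
  with first-order conditions on membership so that its definability in a model can be decomposed.\<close>

definition block :: "'a set \<Rightarrow> 'a set" where
  "block A = {z. if M \<subseteq> A then z = a1 \<or> z = a2
     else if \<exists>b. \<forall>u. u \<in> M \<and> u \<notin> A \<longleftrightarrow> u = b then z \<in> A \<and> z \<noteq> a0
     else z \<in> A}"

definition code :: "'a set \<Rightarrow> 'a \<Rightarrow> 'a \<Rightarrow> bool" where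
  "code A x y \<longleftrightarrow> (if a0 \<in> A then glue (block A) x y else (x \<in> A \<longleftrightarrow> y \<in> A))"

lemma equivp_glue: "equivp (glue C)"
  by (rule equivpI) (auto simp: glue_def reflp_def symp_def transp_def)

lemma equivp_code: "equivp (code A)"
proof (cases "a0 \<in> A")
  case True
  then have "code A = glue (block A)" by (simp add: code_def fun_eq_iff)
  then show ?thesis by (simp add: equivp_glue)
next
  case False
  then show ?thesis
    by (intro equivpI) (auto simp: code_def reflp_def symp_def transp_def)
qed

lemma block_cases [consumes 2, case_names all all_but_one other]:
  assumes "A \<subseteq> M" "a0 \<in> A"
  obtains "A = M" "block A = {a1, a2}"
  | b where "b \<in> M" "b \<noteq> a0" "A = M - {b}" "block A = M - {a0, b}"
  | b c where "b \<in> M" "c \<in> M" "b \<noteq> c" "b \<notin> A" "c \<notin> A" "block A = A"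
proof (cases "M \<subseteq> A")
  case True
  with assms have "A = M" "block A = {a1, a2}" by (auto simp: block_def)
  then show thesis by (rule that(1))
next
  case False
  show thesis
  proof (cases "\<exists>b. \<forall>u. u \<in> M \<and> u \<notin> A \<longleftrightarrow> u = b")
    case True
    then obtain b where b: "\<And>u. u \<in> M \<and> u \<notin> A \<longleftrightarrow> u = b" by blast
    have "block A = A - {a0}" using False True by (auto simp: block_def)
    moreover have "A = M - {b}" using assms(1) b by blast
    ultimately show thesis using that(2)[of b] b assms(2) by blast
  next
    case no: False
    have "block A = A" using False no by (auto simp: block_def)
    moreover obtain b where "b \<in> M" "b \<notin> A" using False by blast
    moreover with no obtain c where "c \<in> M" "c \<notin> A" "c \<noteq> b" by metis
    ultimately show thesis using that(3)[of b c] by blast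
  qed
qed

lemma glue_three_classes:
  assumes "c \<in> C" "b \<notin> C" "b' \<notin> C" "b \<noteq> b'"
  shows "\<not> glue C b b'" "\<not> glue C b c" "\<not> glue C b' c"
  using assms by (auto simp: glue_def)

text \<open>The partition that codes a set containing \<open>a\<^sub>0\<close> has at least three classes: the block,
  and two singletons outside it. The codes of the other sets have at most two.\<close>

lemma block_missing_two:
  assumes "A \<subseteq> M" "a0 \<in> A"
  obtains b b' c where "b \<in> M" "b' \<in> M" "c \<in> M" "c \<in> block A" "b \<notin> block A" "b' \<notin> block A" "b \<noteq> b'"
  using assms
proof (cases rule: block_cases)
  case all
  with points distinct show thesis using that[of a0 a3 a1] by auto
next
  case (all_but_one b)
  obtain c where "c \<in> M" "c \<noteq> a0" "c \<noteq> b"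
    using points distinct by (metis distinct_length_2_or_more)
  with all_but_one points show thesis using that[of a0 b c] by auto
next
  case (other b c)
  with assms points show thesis using that[of b c a0] by auto
qed

text \<open>A block with at least two elements is determined by its relation; one-element blocks are not, as
  they all give equality.\<close>

lemma glue_inject:
  assumes "\<And>x y. x \<in> M \<Longrightarrow> y \<in> M \<Longrightarrow> glue C x y \<longleftrightarrow> glue D x y"
    and "C \<subseteq> M" "D \<subseteq> M" "c \<in> C" "c' \<in> C" "c \<noteq> c'"
  shows "C = D"
proof -
  have "c \<in> D" "c' \<in> D" using assms(1)[of c c'] assms(2,4-6) by (auto simp: glue_def)
  have "z \<in> C \<longleftrightarrow> z \<in> D" if "z \<in> M" for z
    using assms(1)[OF that, of c] assms(1)[OF that, of c'] assms(2,4-6) \<open>c \<in> D\<close> \<open>c' \<in> D\<close>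
    by (auto simp: glue_def)
  with assms(2,3) show ?thesis by blast
qed

lemma block_subset: "A \<subseteq> M \<Longrightarrow> block A \<subseteq> M"
  using points by (auto simp: block_def split: if_splits)

text \<open>The set \<open>{a\<^sub>0}\<close> is thus the only one containing \<open>a\<^sub>0\<close> that is coded by equality, which makes the exception in
  \<open>glue_inject\<close> harmless.\<close>

lemma block_singleton:
  assumes "A \<subseteq> M" "a0 \<in> A" "\<And>c c'. c \<in> block A \<Longrightarrow> c' \<in> block A \<Longrightarrow> c = c'"
  shows "A = {a0}"
  using assms(1,2)
proof (cases rule: block_cases)
  case all
  with assms(3)[of a1 a2] distinct show ?thesis by auto
next
  case (all_but_one b)
  then have "c = c'" if "c \<in> M" "c' \<in> M" "c \<notin> {a0, b}" "c' \<notin> {a0, b}" for c c'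
    using assms(3) that by blast
  from this[of a1 a2] this[of a1 a3] this[of a2 a3] points distinct show ?thesis by auto
next
  case (other b c)
  with assms(2,3) show ?thesis by blast
qed

text \<open>The three cases are told apart by the block itself. A fifth point is what prevents
  \<open>M - {a\<^sub>0, b} = {a\<^sub>1, a\<^sub>2}\<close>: of \<open>a\<^sub>3\<close> and \<open>a\<^sub>4\<close>, at most one
  equals \<open>b\<close>.\<close>

lemma block_recover:
  assumes "A \<subseteq> M" "a0 \<in> A"
  shows "A = (if a0 \<in> block A then block A else if block A = {a1, a2} then M
    else insert a0 (block A))"
  using assms
proof (cases rule: block_cases)
  case all
  with distinct show ?thesis by simp
next
  case (all_but_one b)
  have "block A \<noteq> {a1, a2}"
  proof
    assume "block A = {a1, a2}"
    then have "M - {a0, b} = {a1, a2}" using all_but_one(4) by simp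
    then have "a3 \<in> {a0, b, a1, a2}" "a4 \<in> {a0, b, a1, a2}" using points by blast+
    with distinct show False by auto
  qed
  moreover have "a0 \<notin> block A" "A = insert a0 (block A)"
    using all_but_one points by auto
  ultimately show ?thesis by simp
next
  case other
  with assms(2) show ?thesis by simp
qed

lemma block_inject:
  assumes "A \<subseteq> M" "a0 \<in> A" "B \<subseteq> M" "a0 \<in> B" "block A = block B"
  shows "A = B"
  using block_recover[OF assms(1,2), unfolded assms(5)] block_recover[OF assms(3,4)]
  by (rule trans[OF _ sym])

lemma code_two_classes:
  assumes "a0 \<notin> A"
  shows "code A x y \<or> code A x z \<or> code A y z"
  using assms by (auto simp: code_def)

lemma code_inject:
  assumes A: "A \<subseteq> M" and B: "B \<subseteq> M"
    and eq: "\<And>x y. x \<in> M \<Longrightarrow> y \<in> M \<Longrightarrow> code A x y \<longleftrightarrow> code B x y"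
  shows "A = B"
proof -
  \<comment> \<open>at most two classes on one side, at least three on the other\<close>
  have mixed: False
    if "A \<subseteq> M" "B \<subseteq> M" "a0 \<notin> A" "a0 \<in> B"
      "\<And>x y. x \<in> M \<Longrightarrow> y \<in> M \<Longrightarrow> code A x y \<longleftrightarrow> code B x y" for A B
  proof -
    note sub = that(2) and mem = that(4)
    obtain b b' c where b: "b \<in> M" "b' \<in> M" "c \<in> M" "c \<in> block B" "b \<notin> block B" "b' \<notin> block B" "b \<noteq> b'"
      using block_missing_two[OF sub mem] .
    have "\<not> code B b b'" "\<not> code B b c" "\<not> code B b' c"
      using glue_three_classes[OF b(4-7)] that(4) by (auto simp: code_def)
    with that(5) b code_two_classes[OF that(3), of b b' c] show False by blast
  qed
  consider "a0 \<notin> A" "a0 \<notin> B" | "a0 \<in> A" "a0 \<in> B" | "a0 \<notin> A" "a0 \<in> B" | "a0 \<in> A" "a0 \<notin> B"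
    by blast
  then show ?thesis
  proof cases
    case 1
    have "z \<in> A \<longleftrightarrow> z \<in> B" if "z \<in> M" for z
      using eq[OF that points(1)] 1 by (simp add: code_def)
    with A B show ?thesis by blast
  next
    case 2
    then have glue: "glue (block A) x y \<longleftrightarrow> glue (block B) x y" if "x \<in> M" "y \<in> M" for x y
      using eq[OF that] by (simp add: code_def)
    note subs = block_subset[OF A] block_subset[OF B]
    show ?thesis
    proof (cases "block A = block B")
      case True
      then show ?thesis by (rule block_inject[OF A 2(1) B 2(2)])
    next
      case False
      have "A = {a0}"
      proof (rule block_singleton[OF A 2(1)], rule ccontr)
        fix c c' assume c: "c \<in> block A" "c' \<in> block A" "c \<noteq> c'"
        have "block A = block B"
          by (rule glue_inject[OF _ subs c]) (rule glue; assumption)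
        with False show False ..
      qed
      moreover have "B = {a0}"
      proof (rule block_singleton[OF B 2(2)], rule ccontr)
        fix c c' assume c: "c \<in> block B" "c' \<in> block B" "c \<noteq> c'"
        have "block B = block A"
          by (rule glue_inject[OF _ subs(2,1) c]) (rule glue[symmetric]; assumption)
        with False show False by simp
      qed
      ultimately show ?thesis by simp
    qed
  next
    case 3
    have False by (rule mixed[OF A B 3]) (rule eq; assumption)
    then show ?thesis ..
  next
    case 4
    have False by (rule mixed[OF B A 4(2,1)]) (rule eq[symmetric]; assumption)
    then show ?thesis ..
  qed
qed

text \<open>The block \<open>{a\<^sub>1, a\<^sub>3}\<close> leaves out \<open>a\<^sub>0, a\<^sub>2, a\<^sub>4\<close>. So there are too many
  classes for a code of the first kind, and no set containing \<open>a\<^sub>0\<close> has this block: it omits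
  \<open>a\<^sub>0\<close>, is not \<open>{a\<^sub>1, a\<^sub>2}\<close>, and omits more than two points.\<close>

lemma code_misses:
  assumes A: "A \<subseteq> M"
  shows "\<exists>x\<in>M. \<exists>y\<in>M. \<not> (code A x y \<longleftrightarrow> glue {a1, a3} x y)"
proof (rule ccontr)
  assume "\<not> ?thesis"
  then have eq: "code A x y \<longleftrightarrow> glue {a1, a3} x y" if "x \<in> M" "y \<in> M" for x y
    using that by blast
  show False
  proof (cases "a0 \<in> A")
    case False
    have "\<not> glue {a1, a3} a0 a2" "\<not> glue {a1, a3} a0 a4" "\<not> glue {a1, a3} a2 a4"
      using distinct by (auto simp: glue_def)
    with eq points code_two_classes[OF False, of a0 a2 a4] show False by blast
  next
    case True
    have "{a1, a3} = block A"
    proof (rule glue_inject[where c = a1 and c' = a3])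
      show "glue {a1, a3} x y \<longleftrightarrow> glue (block A) x y" if "x \<in> M" "y \<in> M" for x y
        using eq[OF that] True by (simp add: code_def)
    qed (use points distinct block_subset[OF A] in auto)
    moreover have "a0 \<notin> {a1, a3}" "a2 \<notin> {a1, a3}" "a4 \<notin> {a1, a3}"
      using distinct by auto
    ultimately have missing: "a0 \<notin> block A" "a2 \<notin> block A" "a4 \<notin> block A" by simp_all
    from A True show False
    proof (cases rule: block_cases)
      case all
      with missing show False by simp
    next
      case (all_but_one b)
      with missing points distinct have "a2 = b" "a4 = b" by auto
      with distinct show False by simp
    next
      case other
      with missing True show False by simp
    qed
  qed
qed

end

context zf
begin

section \<open>The power set embeds properly into the set of partitions\<close>

lemma definable_if:
  assumes "definable P" "definable Q" "definable R"
  shows "definable (\<lambda>v. if P v then Q v else R v)"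
  unfolding if_bool_eq_disj by (intro definable_intros assms)

abbreviation elements :: "'a \<Rightarrow> 'a set" where
  "elements x \<equiv> {z. E z x}"

text \<open>The coding, applied to the elements of members of the power set. All its ingredients are first-order
  conditions in \<open>A\<close>, \<open>m\<close> and the five points, so the map is a function of the model.\<close>

lemma Power_injects_properly_into_Partitions:
  assumes "{a0, a1, a2, a3, a4} \<subseteq> elements m" "distinct [a0, a1, a2, a3, a4]"
  obtains f q where "is_injection E f (Power E m) (Partitions E m)"
    "E q (Partitions E m)" "\<And>A. \<not> maps_to E f A q"
proof -
  interpret five_points "elements m" a0 a1 a2 a3 a4
    using assms by unfold_locales auto
  note unfolds = code_def glue_def block_def mem_Collect_eq subset_iff
  define cd where "cd A = code (elements A)" for A
  have def_code: "definable (\<lambda>v. cd (v i) (v j) (v k))" for i j k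
    unfolding cd_def unfolds by (intro definable_intros definable_if)
  have def_code_at: "definable (\<lambda>v. cd A (v 0) (v 1))" for A
    unfolding cd_def unfolds by (intro definable_intros definable_if)
  have def_glue: "definable (\<lambda>v. glue {a1, a3} (v 0) (v 1))"
  proof -
    have "z \<in> {a1, a3} \<longleftrightarrow> z = a1 \<or> z = a3" for z by simp
    then show ?thesis
      by (simp only: glue_def) (intro definable_intros)
  qed
  have eqv: "equivp (cd A)" for A unfolding cd_def by (rule equivp_code)
  define F where "F A = quotient m (cd A)" for A
  let ?G = "\<lambda>A p. \<forall>s. E s p \<longleftrightarrow> (\<exists>x. E x m \<and> (\<forall>z. E z s \<longleftrightarrow> E z m \<and> cd A x z))"
  have graph: "?G A p \<longleftrightarrow> p = F A" for A p
  proof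
    assume G: "?G A p"
    show "p = F A"
      unfolding F_def by (rule extensionality[OF ZF]) (simp only: mem_quotient[OF def_code_at] G)
  qed (simp only: F_def mem_quotient[OF def_code_at] simp_thms)
  have F_part: "E (F A) (Partitions E m)" for A
    unfolding F_def Partitions_mem[OF ZF] by (rule is_partition_quotient[OF def_code_at eqv])
  have def_G: "definable (\<lambda>v. ?G (v 0) (v 1))"
    by (intro definable_intros def_code)
  have total: "\<exists>!p. E p (Partitions E m) \<and> ?G A p" if "E A (Power E m)" for A
    unfolding graph using F_part by blast
  obtain f where f: "is_function E f (Power E m) (Partitions E m)"
      "\<And>A p. maps_to E f A p \<longleftrightarrow> E A (Power E m) \<and> E p (Partitions E m) \<and> ?G A p"
    using definable_function_exists[where R = ?G, OF def_G total] by blast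
  have subs: "elements A \<subseteq> elements m" if "E A (Power E m)" for A
    using that unfolding Power_mem[OF ZF] subset_of_def by blast
  have "A = B" if "maps_to E f A p" "maps_to E f B p" for A B p
  proof -
    have Pow: "E A (Power E m)" "E B (Power E m)" and "p = F A" "p = F B"
      using that unfolding f(2) graph by auto
    then have eq: "quotient m (cd A) = quotient m (cd B)" by (simp add: F_def)
    have "cd A x y \<longleftrightarrow> cd B x y" if "E x m" "E y m" for x y
      by (rule quotient_inject[OF def_code_at eqv def_code_at eqv eq that])
    then have "elements A = elements B"
      by (intro code_inject subs Pow) (simp add: cd_def)
    then show "A = B" by (intro extensionality[OF ZF]) blast
  qed
  with f(1) have "is_injection E f (Power E m) (Partitions E m)"
    unfolding is_injection_def by blast
  moreover have "E (quotient m (glue {a1, a3})) (Partitions E m)"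
    unfolding Partitions_mem[OF ZF] by (rule is_partition_quotient[OF def_glue equivp_glue])
  moreover have "\<not> maps_to E f A (quotient m (glue {a1, a3}))" for A
  proof
    assume "maps_to E f A (quotient m (glue {a1, a3}))"
    then have A: "E A (Power E m)" and eq: "quotient m (glue {a1, a3}) = quotient m (cd A)"
      unfolding f(2) graph F_def by auto
    from code_misses[OF subs[OF A]] obtain x y
      where xy: "E x m" "E y m" and differ: "\<not> (cd A x y \<longleftrightarrow> glue {a1, a3} x y)"
      unfolding cd_def by blast
    from quotient_inject[OF def_glue equivp_glue def_code_at eqv eq xy] differ show False by blast
  qed
  ultimately show thesis by (rule that)
qed

lemma num_mem: "i < j \<Longrightarrow> E (num E i) (num E j)"
proof (induction j)
  case (Suc j)
  then show ?case by (auto simp only: num_Suc_mem[OF ZF] less_Suc_eq)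
qed simp

lemma num_inject: "num E i = num E j \<longleftrightarrow> i = j"
  using num_mem[of i j] num_mem[of j i] mem_asym by (metis nat_neq_iff)

text \<open>The function \<open>c\<close> belongs to HOL, as only its values, taken as parameters, enter the model. The
  inequality of cardinals concerns some representatives \<open>x\<close> and \<open>y\<close>; the points are pulled
  back to \<open>m\<close> through the bijections with them.\<close>

lemma injects_numeral:
  assumes "cardinal_le E (fin_card E n) (cardinality E m)"
  shows "\<exists>c. inj_on c {..<n} \<and> c ` {..<n} \<subseteq> elements m"
proof -
  obtain x y f where "equinumerous E (num E n) x" "equinumerous E m y" and f: "is_injection E f x y"
    using assms unfolding cardinal_le_def fin_card_def cardinality_def by blast
  then obtain g h where g: "is_bijection E g (num E n) x" and h: "is_bijection E h m y"
    unfolding equinumerous_def by blast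
  define T where "T k c \<longleftrightarrow> (\<exists>p q. maps_to E g k p \<and> maps_to E f p q \<and> maps_to E h c q)" for k c
  have fg: "is_function E g (num E n) x" and ff: "is_function E f x y" and fh: "is_function E h m y"
    using f g h unfolding is_bijection_def is_injection_def by blast+
  have "\<exists>c. E c m \<and> T k c" if k: "E k (num E n)" for k
  proof -
    obtain p where p: "maps_to E g k p" using is_function_total[OF fg k] ..
    obtain q where q: "maps_to E f p q"
      using is_function_total[OF ff is_function_dom_cod(2)[OF fg p]] ..
    obtain c where "maps_to E h c q"
      using h is_function_dom_cod(2)[OF ff q] unfolding is_bijection_def by blast
    with p q is_function_dom_cod(1)[OF fh] show ?thesis unfolding T_def by blast
  qed
  then have "\<forall>i\<in>{..<n}. \<exists>c. E c m \<and> T (num E i) c" using num_mem by blast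
  then obtain c where c: "\<forall>i\<in>{..<n}. E (c i) m \<and> T (num E i) (c i)" by (rule bchoice[THEN exE])
  have "k = k'" if "T k c" "T k' c" for k k' c
    using that f g is_function_unique[OF fh]
    unfolding T_def is_bijection_def is_injection_def by blast
  then have "inj_on c {..<n}" using c num_inject unfolding inj_on_def by metis
  with c show ?thesis by blast
qed

lemma subsets_eq_if_agree_on_image:
  assumes j: "is_bijection E j m n" and "E A (Power E n)" "E B (Power E n)"
    and "\<And>x y. maps_to E j x y \<Longrightarrow> E y A \<longleftrightarrow> E y B"
  shows "A = B"
proof (rule extensionality[OF ZF])
  fix z
  have "E z n \<Longrightarrow> E z A \<longleftrightarrow> E z B"
    using j assms(4) unfolding is_bijection_def by blast
  with assms(2,3) show "E z A \<longleftrightarrow> E z B"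
    unfolding Power_mem[OF ZF] subset_of_def by blast
qed

text \<open>Taking preimages under \<open>j\<close> is injective as soon as \<open>j\<close> is surjective.\<close>

lemma Power_preimage:
  assumes j: "is_bijection E j m n"
  obtains f where "is_injection E f (Power E n) (Power E m)"
proof -
  let ?R = "\<lambda>A B. \<forall>x. E x B \<longleftrightarrow> (\<exists>y. E y A \<and> maps_to E j x y)"
  have fj: "is_function E j m n" using j unfolding is_bijection_def is_injection_def by blast
  have total: "\<exists>!B. E B (Power E m) \<and> ?R A B" for A
  proof -
    have "definable (\<lambda>v. \<exists>y. E y A \<and> maps_to E j (v 0) y)" by (intro definable_intros)
    from comprehension[where P = "\<lambda>x. \<exists>y. E y A \<and> maps_to E j x y", OF this, of m]
    obtain B where "\<And>x. E x B \<longleftrightarrow> E x m \<and> (\<exists>y. E y A \<and> maps_to E j x y)" by blast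
    then have B: "E B (Power E m)" "?R A B"
      using is_function_dom_cod[OF fj] unfolding Power_mem[OF ZF] subset_of_def by blast+
    show ?thesis
    proof (rule ex1I)
      show "E B (Power E m) \<and> ?R A B" using B by (rule conjI)
      show "B' = B" if "E B' (Power E m) \<and> ?R A B'" for B'
        by (rule extensionality[OF ZF]) (simp only: B(2) that)
    qed
  qed
  have "definable (\<lambda>v. ?R (v 0) (v 1))" by (intro definable_intros)
  from definable_function_exists[where R = ?R, OF this total]
  obtain f where f: "is_function E f (Power E n) (Power E m)"
      "\<And>A B. maps_to E f A B \<longleftrightarrow> E A (Power E n) \<and> E B (Power E m) \<and> ?R A B"
    by blast
  have mem: "E x B \<longleftrightarrow> E y A" if "maps_to E f A B" "maps_to E j x y" for A B x y
  proof -
    have "?R A B" using that(1) unfolding f(2) by blast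
    then show ?thesis using that(2) is_function_unique[OF fj that(2)] by blast
  qed
  have "A = A'" if maps: "maps_to E f A B" "maps_to E f A' B" for A A' B
  proof (rule subsets_eq_if_agree_on_image[OF j])
    show "E A (Power E n)" "E A' (Power E n)"
      using maps is_function_dom_cod(1)[OF f(1)] by blast+
    show "E y A \<longleftrightarrow> E y A'" if "maps_to E j x y" for x y
      using mem[OF maps(1) that] mem[OF maps(2) that] by blast
  qed
  with f(1) have "is_injection E f (Power E n) (Power E m)"
    unfolding is_injection_def by blast
  then show thesis by (rule that)
qed

lemma is_injection_compose:
  assumes f: "is_injection E f x y" and g: "is_injection E g y z"
  obtains h where "is_injection E h x z" "\<And>a c. maps_to E h a c \<longleftrightarrow> (\<exists>b. maps_to E f a b \<and> maps_to E g b c)"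
proof -
  let ?R = "\<lambda>a c. \<exists>b. maps_to E f a b \<and> maps_to E g b c"
  have ff: "is_function E f x y" and fg: "is_function E g y z"
    using f g unfolding is_injection_def by blast+
  have R: "definable (\<lambda>v. ?R (v 0) (v 1))" by (intro definable_intros)
  have total: "\<exists>!c. E c z \<and> ?R a c" if a: "E a x" for a
  proof -
    obtain b where b: "maps_to E f a b" using is_function_total[OF ff a] ..
    obtain c where c: "maps_to E g b c"
      using is_function_total[OF fg is_function_dom_cod(2)[OF ff b]] ..
    show ?thesis
    proof (rule ex1I)
      show "E c z \<and> ?R a c" using b c is_function_dom_cod(2)[OF fg c] by blast
      show "d = c" if "E d z \<and> ?R a d" for d
        using that b c is_function_unique[OF ff] is_function_unique[OF fg] by blast
    qed
  qed
  from definable_function_exists[where R = ?R, OF R total]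
  obtain h where h: "is_function E h x z" "\<And>a c. maps_to E h a c \<longleftrightarrow> E a x \<and> E c z \<and> ?R a c"
    by blast
  then have maps: "maps_to E h a c \<longleftrightarrow> ?R a c" for a c
    using is_function_dom_cod[OF ff] is_function_dom_cod[OF fg] by blast
  have "is_injection E h x z"
    using h(1) f g unfolding is_injection_def maps by blast
  then show thesis using maps by (rule that)
qed

lemma is_bijection_inverse:
  assumes "is_bijection E f x y"
  obtains g where "is_injection E g y x" "\<And>a b. maps_to E g b a \<longleftrightarrow> maps_to E f a b"
proof -
  let ?R = "\<lambda>b a. maps_to E f a b"
  have ff: "is_function E f x y" and inj: "\<And>a a' b. maps_to E f a b \<Longrightarrow> maps_to E f a' b \<Longrightarrow> a = a'"
    and surj: "\<And>b. E b y \<Longrightarrow> \<exists>a. maps_to E f a b"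
    using assms unfolding is_bijection_def is_injection_def by blast+
  have R: "definable (\<lambda>v. ?R (v 0) (v 1))" by (intro definable_intros)
  have total: "\<exists>!a. E a x \<and> ?R b a" if "E b y" for b
    using surj[OF that] inj is_function_dom_cod[OF ff] by blast
  from definable_function_exists[where R = ?R, OF R total]
  obtain g where g: "is_function E g y x" "\<And>b a. maps_to E g b a \<longleftrightarrow> E b y \<and> E a x \<and> maps_to E f a b"
    by blast
  then have maps: "maps_to E g b a \<longleftrightarrow> maps_to E f a b" for a b
    using is_function_dom_cod[OF ff] by blast
  have "is_injection E g y x"
    using g(1) is_function_unique[OF ff] unfolding is_injection_def maps by blast
  then show thesis using maps by (rule that)
qed

end

theorem proposition8p3:
  fixes E :: "'a \<Rightarrow> 'a \<Rightarrow> bool" and \<mm> :: "'a set"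
  assumes "ZF_model E"
    and "is_cardinal E \<mm>"
    and "cardinal_le E (fin_card E 5) \<mm>"
    and "\<not> cardinal_le E (aleph0 E) (two_pow E \<mm>)"
  shows "cardinal_less E (two_pow E \<mm>) (part E \<mm>)"
proof -
  interpret zf E by unfold_locales (rule assms(1))
  obtain m where m: "\<mm> = cardinality E m"
    using assms(2) unfolding is_cardinal_def by blast
  have Pow: "Power E m \<in> two_pow E \<mm>" and Part: "Partitions E m \<in> part E \<mm>"
    using cardinality_self unfolding m two_pow_def part_def by blast+
  obtain c :: "nat \<Rightarrow> 'a" where "inj_on c {..<5} \<and> c ` {..<5} \<subseteq> elements m"
    using injects_numeral[OF assms(3)[unfolded m]] ..
  moreover have "{..<5} = {0, 1, 2, 3, 4::nat}" by auto
  ultimately have inj: "inj_on c {0, 1, 2, 3, 4}" and sub: "c ` {0, 1, 2, 3, 4} \<subseteq> elements m"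
    by simp_all
  from inj have "distinct (map c [0, 1, 2, 3, 4])"
    by (simp only: distinct_map list.set) simp
  then have dist: "distinct [c 0, c 1, c 2, c 3, c 4]"
    by (simp only: list.map)
  from sub have "{c 0, c 1, c 2, c 3, c 4} \<subseteq> elements m"
    by (simp only: image_insert image_empty)
  from this dist obtain f q where f: "is_injection E f (Power E m) (Partitions E m)"
      and q: "E q (Partitions E m)" "\<And>A. \<not> maps_to E f A q"
    by (rule Power_injects_properly_into_Partitions) blast
  \<comment> \<open>Were they equal, composing \<open>f\<close> with a bijection back would give an injective self-map
     \<open>h\<close> of the power set that misses the image \<open>B\<close> of \<open>q\<close>. The classes united in
     \<open>two_pow\<close> belong to various representatives \<open>n\<close>, whence the detour through \<open>j\<close>.\<close>
  have "two_pow E \<mm> \<noteq> part E \<mm>"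
  proof
    assume "two_pow E \<mm> = part E \<mm>"
    with Part obtain n where "equinumerous E m n" "equinumerous E (Power E n) (Partitions E m)"
      unfolding two_pow_def m cardinality_def by blast
    then obtain j b where j: "is_bijection E j m n"
      and b: "is_bijection E b (Power E n) (Partitions E m)"
      unfolding equinumerous_def by blast
    obtain b' where b': "is_injection E b' (Partitions E m) (Power E n)"
      by (rule is_bijection_inverse[OF b])
    obtain j' where j': "is_injection E j' (Power E n) (Power E m)"
      using Power_preimage[OF j] .
    obtain g where g: "is_injection E g (Partitions E m) (Power E m)"
      by (rule is_injection_compose[OF b' j'])
    obtain h where h: "is_injection E h (Power E m) (Power E m)"
      and h_eq: "\<And>A B. maps_to E h A B \<longleftrightarrow> (\<exists>p. maps_to E f A p \<and> maps_to E g p B)"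
      by (rule is_injection_compose[OF f g]) blast
    have fun_g: "is_function E g (Partitions E m) (Power E m)"
      using g unfolding is_injection_def by blast
    obtain B where B: "maps_to E g q B" using is_function_total[OF fun_g q(1)] ..
    have "\<not> maps_to E h A B" for A
      using B g q(2) unfolding h_eq is_injection_def by blast
    then obtain k where "is_injection E k (omega E) (Power E m)"
      using omega_injects_if_dedekind_infinite[OF h is_function_dom_cod(2)[OF fun_g B]] by blast
    with Pow cardinality_self have "cardinal_le E (aleph0 E) (two_pow E \<mm>)"
      unfolding cardinal_le_def aleph0_def by blast
    with assms(4) show False ..
  qed
  moreover have "cardinal_le E (two_pow E \<mm>) (part E \<mm>)"
    unfolding cardinal_le_def using Pow Part f by blast
  ultimately show ?thesis unfolding cardinal_less_def by blast
qed

end
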